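(* Let $K\subset\mathbb{C}$ be a Vitushkin compactum. Let $Z\subset\overline{\mathbb{C}}$ be a set which meets every component of $\overline{\mathbb{C}}\setminus K$, where $\overline{\mathbb{C}}=\mathbb{C}\cup\{\infty\}$ is the Riemann sphere. Let $f\in A(K)$ and $\varepsilon>0$. Then there exist finitely many points $z_1,\ldots,z_N\in Z$ and Dirichlet polynomials $P^{(1)},\ldots,P^{(N)}$ so that the "rational Dirichlet" function $$R(s)=P^{(1)}_{z_1}(s)+\ldots+P^{(N)}_{z_N}(s)$$ satisfies $\|f-R\|_{C(K)}<\varepsilon$.
   Context: For compact $K\subset\mathbb{C}$: $A(K)$ is the set of functions $K\to\mathbb{C}$ that are continuous on $K$ and holomorphic on the interior of $K$; $R(K)$ is the set of functions $K\to\mathbb{C}$ that are uniform limits on $K$ of rational functions with no poles on $K$; $K$ is called a Vitushkin set (Vitushkin compactum) if $R(K)=A(K)$. $\|\cdot\|_{C(K)}$ is the supremum norm on $K$. A Dirichlet polynomial is a function $P(s)=\sum_{n=1}^{M}a_n\frac{1}{n^s}$ with $M\in\mathbb{N}$, $a_n\in\mathbb{C}$. For a Dirichlet polynomial $P$ and $a\in\mathbb{C}$, $P_a(s)=P(1/(s-a))$; for $a=\infty$, $P_\infty=P$. *)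

theory Defs
  imports "HOL-Analysis.Analysis" "HOL-Computational_Algebra.Polynomial"
begin

text \<open>
  Functions on \<open>K\<close> are represented by total functions of which only the values on \<open>K\<close> matter:
  membership in each of the function classes below depends only on the restriction to \<open>K\<close>.
\<close>

definition A_algebra :: "complex set \<Rightarrow> (complex \<Rightarrow> complex) set"
  where "A_algebra K = {f. continuous_on K f \<and> f holomorphic_on interior K}"

text \<open>
  Taking a quotient in lowest terms, a rational function has no poles on \<open>K\<close> iff it has a
  representation whose denominator has no zeros on \<open>K\<close>; the condition \<open>q \<noteq> 0\<close> only matters for
  empty \<open>K\<close>.
\<close>

definition rational_without_poles_on :: "complex set \<Rightarrow> (complex \<Rightarrow> complex) \<Rightarrow> bool"
  where "rational_without_poles_on K r \<longleftrightarrow>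
    (\<exists>p q :: complex poly. q \<noteq> 0 \<and> (\<forall>s\<in>K. poly q s \<noteq> 0 \<and> r s = poly p s / poly q s))"

definition R_algebra :: "complex set \<Rightarrow> (complex \<Rightarrow> complex) set"
  where "R_algebra K =
    {f. \<exists>r :: nat \<Rightarrow> complex \<Rightarrow> complex.
          (\<forall>n. rational_without_poles_on K (r n)) \<and> uniform_limit K r f sequentially}"

definition vitushkin_compactum :: "complex set \<Rightarrow> bool"
  where "vitushkin_compactum K \<longleftrightarrow> compact K \<and> R_algebra K = A_algebra K"

text \<open>
  The case distinction is needed because \<open>Sup {}\<close> is unspecified for real numbers. For nonempty
  \<open>K\<close> the value is meaningful only if \<open>g\<close> is bounded on \<open>K\<close>.
\<close>

definition sup_norm_on :: "complex set \<Rightarrow> (complex \<Rightarrow> complex) \<Rightarrow> real"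
  where "sup_norm_on K g = (if K = {} then 0 else (SUP s\<in>K. norm (g s)))"

text \<open>
  The Riemann sphere is the one-point compactification of the plane: \<open>Some a\<close> is the finite
  point \<open>a\<close>, and \<open>None\<close> is the point at infinity.
\<close>

abbreviation riemann_sphere :: "complex option topology"
  where "riemann_sphere \<equiv> Alexandroff_compactification euclidean"

definition dirichlet_polynomial :: "(complex \<Rightarrow> complex) \<Rightarrow> bool"
  where "dirichlet_polynomial P \<longleftrightarrow>
    (\<exists>(M :: nat) (a :: nat \<Rightarrow> complex). P = (\<lambda>s. \<Sum>n = 1..M. a n * (1 / of_nat n powr s)))"

text \<open>
  The function \<open>P\<^sub>a\<close>. For finite \<open>a\<close> it is mathematically defined only for \<open>s \<noteq> a\<close>; its
  value at \<open>s = a\<close> is the artefact \<open>P 0\<close> of division by zero.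
\<close>

definition transplant :: "(complex \<Rightarrow> complex) \<Rightarrow> complex option \<Rightarrow> complex \<Rightarrow> complex"
  where "transplant P z s = (case z of None \<Rightarrow> P s | Some a \<Rightarrow> P (1 / (s - a)))"

end

theory Submission
  imports Defs "HOL-Complex_Analysis.Cauchy_Integral_Formula" "HOL-Real_Asymp.Real_Asymp"
    "HOL-Computational_Algebra.Fundamental_Theorem_Algebra"
begin

text \<open>
  On a Vitushkin compactum \<open>f\<close> is a uniform limit of rational functions without poles on \<open>K\<close>, so
  only rational functions have to be approximated. A partial fraction decomposition splits such a
  function into polynomials in \<open>1 / (s - w)\<close> for poles \<open>w\<close> off \<open>K\<close>, and a polynomial in \<open>s\<close>, which
  belongs to the pole \<open>w = \<infinity>\<close>. Two facts remain.

  \<^item> The poles can be moved into \<open>Z\<close>, as in Runge's theorem. If \<open>v\<close> and \<open>w\<close> are close, then the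
    function with a simple pole at \<open>w\<close> is a geometric series in the one with a simple pole at \<open>v\<close>,
    and conversely. Being a uniform limit of polynomials in another function is a transitive
    relation, so poles in the same component of the complement of \<open>K\<close> in the sphere are
    interchangeable (\<open>simple_poles_equivalent_on_component\<close>).

  \<^item> On bounded sets, every polynomial is a uniform limit of Dirichlet polynomials. Since Dirichlet
    polynomials form an algebra, it suffices to approximate the function \<open>s\<close>
    (\<open>identity_approx_by_dirichlet_polynomial\<close>). Write \<open>n\<^sup>-\<^sup>s\<close> as \<open>exp (- z * s)\<close> with \<open>z = ln n\<close>; then
    \<open>- s\<close> is the derivative at \<open>z = 0\<close> of \<open>exp (- z * s)\<close>, and it can be recovered by interpolation
    at the nodes \<open>0, ln 2, \<dots>, ln N\<close>. The remainder is a contour integral over a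
    circle of radius \<open>3 * ln N\<close>: the \<open>N - 1\<close> nodes provide a factor \<open>2\<close> each, whereas the exponential
    function costs only the power \<open>N powr (3 * \<bar>s\<bar>)\<close>. The logarithms are dense enough for the
    remainder to vanish as \<open>N\<close> grows.

  Composing with \<open>1 / (s - z)\<close>, \<open>z \<in> Z\<close>, turns Dirichlet polynomials close to polynomials into
  rational Dirichlet functions close to the principal parts.
\<close>

section \<open>Interpolation at exponentials\<close>

text \<open>
  The factors are scaled so that their product is \<open>1\<close> at \<open>z = 0\<close>; this makes the coefficient of
  \<open>1 / z\<^sup>2\<close> equal to \<open>1\<close>, independently of the nodes.
\<close>

lemma partial_fractions_simple_nodes:
  fixes \<Lambda> :: "complex set"
  assumes "finite \<Lambda>" "0 \<notin> \<Lambda>"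
  shows "\<exists>c0 c. \<forall>z. z \<notin> insert 0 \<Lambda> \<longrightarrow>
           (\<Prod>x\<in>\<Lambda>. - x / (z - x)) / z\<^sup>2 = 1 / z\<^sup>2 + c0 / z + (\<Sum>x\<in>\<Lambda>. c x / (z - x))"
  using assms
proof (induction \<Lambda> rule: finite_induct)
  case empty
  show ?case by (rule exI[of _ 0]) simp
next
  case (insert y \<Lambda>)
  then obtain c0 c where c: "\<And>z. z \<notin> insert 0 \<Lambda> \<Longrightarrow>
      (\<Prod>x\<in>\<Lambda>. - x / (z - x)) / z\<^sup>2 = 1 / z\<^sup>2 + c0 / z + (\<Sum>x\<in>\<Lambda>. c x / (z - x))"
    by auto
  have y: "y \<noteq> 0" using insert.prems by auto
  define d where "d = (\<lambda>x. - y * c x / (x - y))"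
  define c' where "c' = d(y := - 1 / y - c0 - (\<Sum>x\<in>\<Lambda>. d x))"
  have "(\<Prod>x\<in>insert y \<Lambda>. - x / (z - x)) / z\<^sup>2
      = 1 / z\<^sup>2 + (c0 + 1 / y) / z + (\<Sum>x\<in>insert y \<Lambda>. c' x / (z - x))"
    if z: "z \<notin> insert 0 (insert y \<Lambda>)" for z
  proof -
    have z0: "z \<noteq> 0" "z - y \<noteq> 0" using z by auto
    have "(\<Prod>x\<in>insert y \<Lambda>. - x / (z - x)) / z\<^sup>2
        = - y / (z - y) * ((\<Prod>x\<in>\<Lambda>. - x / (z - x)) / z\<^sup>2)"
      using insert.hyps by simp
    also have "\<dots> = - y / (z - y) * (1 / z\<^sup>2) + - y / (z - y) * (c0 / z)
        + (\<Sum>x\<in>\<Lambda>. - y / (z - y) * (c x / (z - x)))"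
      using z by (subst c) (auto simp: algebra_simps sum_distrib_left)
    also have "- y / (z - y) * (1 / z\<^sup>2) = 1 / z\<^sup>2 + (1 / y) / z + (- 1 / y) / (z - y)"
      using z0 y by (simp add: divide_simps power2_eq_square) (simp add: algebra_simps)
    also have "- y / (z - y) * (c0 / z) = c0 / z - c0 / (z - y)"
      using z0 by (simp add: divide_simps) (simp add: algebra_simps)
    also have "(\<Sum>x\<in>\<Lambda>. - y / (z - y) * (c x / (z - x)))
        = (\<Sum>x\<in>\<Lambda>. d x / (z - x) - d x / (z - y))"
    proof (rule sum.cong[OF refl])
      fix x assume x: "x \<in> \<Lambda>"
      then have "x - y \<noteq> 0" "z - x \<noteq> 0" using insert.hyps z by auto
      then show "- y / (z - y) * (c x / (z - x)) = d x / (z - x) - d x / (z - y)"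
        using z0 by (simp add: d_def divide_simps) (simp add: algebra_simps)
    qed
    also have "\<dots> = (\<Sum>x\<in>\<Lambda>. d x / (z - x)) - (\<Sum>x\<in>\<Lambda>. d x) / (z - y)"
      by (simp add: sum_subtractf sum_divide_distrib)
    also have "(\<Sum>x\<in>\<Lambda>. d x / (z - x)) = (\<Sum>x\<in>\<Lambda>. c' x / (z - x))"
      using insert.hyps by (intro sum.cong) (auto simp: c'_def)
    finally show ?thesis
      using insert.hyps by (simp add: c'_def add_divide_distrib diff_divide_distrib)
  qed
  then show ?case by blast
qed

text \<open>
  Integrate \<open>exp (- z * s)\<close> times the product of the preceding lemma over the circle of radius
  \<open>3 * L\<close>. By Cauchy's formulas, applied to each partial fraction, the double pole contributes the
  derivative \<open>- s\<close> and the simple poles contribute multiples of the exponentials. On the circle,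
  each factor \<open>- x / (z - x)\<close> is at most \<open>L / (3 * L - L) = 1/2\<close> in modulus, so the integral
  is small.
\<close>

lemma identity_approx_by_exponentials:
  fixes \<Lambda> :: "complex set"
  assumes fin: "finite \<Lambda>" and 0: "0 \<notin> \<Lambda>" and L: "L > 0" "\<And>x. x \<in> \<Lambda> \<Longrightarrow> norm x \<le> L"
  shows "\<exists>c0 c. \<forall>s. norm (s - (c0 + (\<Sum>x\<in>\<Lambda>. c x * exp (- x * s))))
           \<le> exp (3 * L * norm s) / (3 * L) * (1/2) ^ card \<Lambda>"
proof -
  obtain c0 c where c: "\<And>z. z \<notin> insert 0 \<Lambda> \<Longrightarrow>
      (\<Prod>x\<in>\<Lambda>. - x / (z - x)) / z\<^sup>2 = 1 / z\<^sup>2 + c0 / z + (\<Sum>x\<in>\<Lambda>. c x / (z - x))"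
    using partial_fractions_simple_nodes[OF fin 0] by auto
  have "norm (s - (c0 + (\<Sum>x\<in>\<Lambda>. c x * exp (- x * s))))
      \<le> exp (3 * L * norm s) / (3 * L) * (1/2) ^ card \<Lambda>" for s
  proof -
    define \<gamma> where "\<gamma> = circlepath 0 (3 * L)"
    define E where "E = (\<lambda>z. exp (- z * s))"
    define I where "I = 2 * of_real pi * \<i> * (- s + c0 + (\<Sum>x\<in>\<Lambda>. c x * E x))"
    have hol: "E holomorphic_on A" for A
      unfolding E_def by (intro holomorphic_intros)
    have E': "(E has_field_derivative - s) (at 0)"
      unfolding E_def by (auto intro!: derivative_eq_intros)
    have 1: "((\<lambda>z. E z / (z - 0) ^ Suc 1) has_contour_integral
        ((2 * pi * \<i>) / (fact 1) * (deriv ^^ 1) E 0)) \<gamma>"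
      unfolding \<gamma>_def using L
      by (intro Cauchy_has_contour_integral_higher_derivative_circlepath holomorphic_on_imp_continuous_on hol) auto
    have 2: "((\<lambda>z. E z / (z - x)) has_contour_integral 2 * of_real pi * \<i> * E x) \<gamma>"
      if "norm x \<le> L" for x
      unfolding \<gamma>_def using L that by (intro Cauchy_integral_circlepath_simple hol) auto
    have "((\<lambda>z. E z / z\<^sup>2 + c0 * (E z / (z - 0)) + (\<Sum>x\<in>\<Lambda>. c x * (E z / (z - x))))
        has_contour_integral
        2 * of_real pi * \<i> * (- s) + c0 * (2 * of_real pi * \<i> * E 0)
          + (\<Sum>x\<in>\<Lambda>. c x * (2 * of_real pi * \<i> * E x))) \<gamma>"
      using 1 L DERIV_imp_deriv[OF E']
      by (intro has_contour_integral_add has_contour_integral_sum has_contour_integral_lmul 2 fin)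
         (auto simp: power2_eq_square)
    also have "2 * of_real pi * \<i> * (- s) + c0 * (2 * of_real pi * \<i> * E 0)
          + (\<Sum>x\<in>\<Lambda>. c x * (2 * of_real pi * \<i> * E x)) = I"
      by (simp add: I_def E_def algebra_simps sum_distrib_left)
    finally have int: "((\<lambda>z. E z / z\<^sup>2 + c0 * (E z / (z - 0)) + (\<Sum>x\<in>\<Lambda>. c x * (E z / (z - x))))
        has_contour_integral I) (circlepath 0 (3 * L))" unfolding \<gamma>_def .
    define B where "B = exp (3 * L * norm s) / (3 * L)\<^sup>2 * (1/2) ^ card \<Lambda>"
    have "norm I \<le> B * (2 * pi * (3 * L))"
    proof (rule has_contour_integral_bound_circlepath[OF int])
      show "0 \<le> B" by (simp add: B_def)
      show "0 < 3 * L" using L by simp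
      fix z :: complex assume "norm (z - 0) = 3 * L"
      then have z: "norm z = 3 * L" by simp
      have "x \<noteq> z" if "x \<in> \<Lambda>" for x using L(2)[OF that] z L(1) by auto
      then have znot: "z \<notin> insert 0 \<Lambda>" using z L by auto
      have "E z / z\<^sup>2 + c0 * (E z / (z - 0)) + (\<Sum>x\<in>\<Lambda>. c x * (E z / (z - x)))
          = E z * (1 / z\<^sup>2 + c0 / z + (\<Sum>x\<in>\<Lambda>. c x / (z - x)))"
        by (simp add: algebra_simps sum_distrib_left)
      also have "\<dots> = E z * ((\<Prod>x\<in>\<Lambda>. - x / (z - x)) / z\<^sup>2)"
        using c[OF znot] by simp
      also have "norm \<dots> = norm (E z) * (\<Prod>x\<in>\<Lambda>. norm (- x / (z - x))) / (3 * L)\<^sup>2"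
        by (simp add: norm_mult norm_divide norm_power z prod_norm[symmetric])
      also have "\<dots> \<le> exp (3 * L * norm s) * (\<Prod>x\<in>\<Lambda>. 1/2) / (3 * L)\<^sup>2"
      proof (intro divide_right_mono mult_mono prod_mono)
        have "Re (- z * s) \<le> norm (- z * s)" by (rule complex_Re_le_cmod)
        then show "norm (E z) \<le> exp (3 * L * norm s)"
          by (simp add: E_def norm_mult z)
        fix x assume x: "x \<in> \<Lambda>"
        have "norm z - norm x \<le> norm (z - x)" by (rule norm_triangle_ineq2)
        then have "2 * L \<le> norm (z - x)" using L(2)[OF x] z by simp
        then show "0 \<le> norm (- x / (z - x)) \<and> norm (- x / (z - x)) \<le> 1 / 2"
          using L(2)[OF x] L(1) by (simp add: norm_divide divide_simps)
      qed (auto intro: prod_nonneg)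
      finally show "norm (E z / z\<^sup>2 + c0 * (E z / (z - 0)) + (\<Sum>x\<in>\<Lambda>. c x * (E z / (z - x)))) \<le> B"
        by (simp add: B_def)
    qed
    moreover have "norm I = 2 * pi * norm (- s + c0 + (\<Sum>x\<in>\<Lambda>. c x * E x))"
      by (simp add: I_def norm_mult)
    ultimately have "norm (- s + c0 + (\<Sum>x\<in>\<Lambda>. c x * E x)) \<le> B * (3 * L)"
      by (simp add: algebra_simps)
    also have "B * (3 * L) = exp (3 * L * norm s) / (3 * L) * (1/2) ^ card \<Lambda>"
      using L by (simp add: B_def power2_eq_square)
    also have "norm (- s + c0 + (\<Sum>x\<in>\<Lambda>. c x * E x)) = norm (s - (c0 + (\<Sum>x\<in>\<Lambda>. c x * E x)))"
      by (subst norm_minus_cancel[symmetric]) (simp add: algebra_simps)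
    finally show ?thesis by (simp add: E_def)
  qed
  then show ?thesis by blast
qed

section \<open>Dirichlet polynomials are dense among polynomials\<close>

lemma of_nat_powr_conv_exp:
  fixes s :: complex
  assumes "n \<ge> 1"
  shows "1 / of_nat n powr s = exp (- of_real (ln (real n)) * s)"
  using assms by (simp add: powr_def exp_minus field_simps Suc_le_eq)

lemma dirichlet_polynomial_monomial:
  assumes "k \<ge> 1"
  shows "dirichlet_polynomial (\<lambda>s. a * (1 / of_nat k powr s))"
proof -
  have "(\<Sum>n = 1..k. (if n = k then a else 0) * (1 / of_nat n powr s))
      = (\<Sum>n = 1..k. if n = k then a * (1 / of_nat k powr s) else 0)" for s :: complex
    by (intro sum.cong) auto
  then have sum: "(\<Sum>n = 1..k. (if n = k then a else 0) * (1 / of_nat n powr s))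
      = a * (1 / of_nat k powr s)" for s :: complex
    using assms by simp
  show ?thesis
    unfolding dirichlet_polynomial_def
    by (intro exI[of _ k] exI[of _ "\<lambda>n. if n = k then a else 0"] ext) (rule sum[symmetric])
qed

lemma dirichlet_polynomial_const: "dirichlet_polynomial (\<lambda>s. a)"
  using dirichlet_polynomial_monomial[of 1 a] by (simp add: of_nat_powr_conv_exp)

lemma dirichlet_polynomial_add:
  assumes "dirichlet_polynomial P" "dirichlet_polynomial Q"
  shows "dirichlet_polynomial (\<lambda>s. P s + Q s)"
proof -
  obtain M a N b where P: "P = (\<lambda>s. \<Sum>n = 1..M. a n * (1 / of_nat n powr s))"
    and Q: "Q = (\<lambda>s. \<Sum>n = 1..N. b n * (1 / of_nat n powr s))"
    using assms unfolding dirichlet_polynomial_def by auto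
  define a' b' where "a' = (\<lambda>n. if n \<le> M then a n else 0)" "b' = (\<lambda>n. if n \<le> N then b n else 0)"
  have P': "P s = (\<Sum>n = 1..max M N. a' n * (1 / of_nat n powr s))" for s
    unfolding P by (rule sum.mono_neutral_cong_left) (auto simp: a'_b'_def)
  have Q': "Q s = (\<Sum>n = 1..max M N. b' n * (1 / of_nat n powr s))" for s
    unfolding Q by (rule sum.mono_neutral_cong_left) (auto simp: a'_b'_def)
  show ?thesis
    unfolding dirichlet_polynomial_def P' Q'
    by (intro exI[of _ "max M N"] exI[of _ "\<lambda>n. a' n + b' n"])
       (simp add: sum.distrib[symmetric] add_divide_distrib)
qed

lemma dirichlet_polynomial_sum:
  assumes "\<And>i. i \<in> I \<Longrightarrow> dirichlet_polynomial (P i)"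
  shows "dirichlet_polynomial (\<lambda>s. \<Sum>i\<in>I. P i s)"
  using assms
  by (induction I rule: infinite_finite_induct)
     (auto intro: dirichlet_polynomial_add dirichlet_polynomial_const)

text \<open>
  The frequencies \<open>ln n\<close> form an additive semigroup, because \<open>ln m + ln n = ln (m * n)\<close>.
\<close>

lemma dirichlet_polynomial_mult:
  assumes "dirichlet_polynomial P" "dirichlet_polynomial Q"
  shows "dirichlet_polynomial (\<lambda>s. P s * Q s)"
proof -
  obtain M a N b where P: "P = (\<lambda>s. \<Sum>m = 1..M. a m * (1 / of_nat m powr s))"
    and Q: "Q = (\<lambda>s. \<Sum>n = 1..N. b n * (1 / of_nat n powr s))"
    using assms unfolding dirichlet_polynomial_def by auto
  have "P s * Q s = (\<Sum>m = 1..M. \<Sum>n = 1..N. (a m * b n) * (1 / of_nat (m * n) powr s))" for s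
    unfolding P Q sum_product
  proof (intro sum.cong refl)
    fix m n assume "m \<in> {1..M}" "n \<in> {1..N}"
    then have mn: "m \<ge> 1" "n \<ge> 1" "m * n \<ge> 1" by auto
    then have "ln (real (m * n)) = ln (real m) + ln (real n)"
      by (simp add: ln_mult)
    then show "a m * (1 / of_nat m powr s) * (b n * (1 / of_nat n powr s))
        = a m * b n * (1 / of_nat (m * n) powr s)"
      unfolding of_nat_powr_conv_exp[OF mn(1)] of_nat_powr_conv_exp[OF mn(2)]
        of_nat_powr_conv_exp[OF mn(3)]
      by (simp add: ring_distribs exp_add exp_diff exp_minus field_simps del: of_nat_mult)
  qed
  moreover have "dirichlet_polynomial
      (\<lambda>s. \<Sum>m = 1..M. \<Sum>n = 1..N. (a m * b n) * (1 / of_nat (m * n) powr s))"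
    by (intro dirichlet_polynomial_sum dirichlet_polynomial_monomial) (simp add: Suc_le_eq)
  ultimately show ?thesis by presburger
qed

lemma dirichlet_polynomial_poly_compose:
  assumes "dirichlet_polynomial P"
  shows "dirichlet_polynomial (\<lambda>s. poly p (P s))"
  by (induction p)
     (auto intro!: dirichlet_polynomial_add dirichlet_polynomial_mult dirichlet_polynomial_const assms)

text \<open>
  With the nodes \<open>ln 2, \<dots>, ln N\<close> the error of the interpolation is at most a constant times
  \<open>N powr (3 * S) / 2 ^ (N - 1)\<close>, which tends to \<open>0\<close>.
\<close>

lemma identity_approx_by_dirichlet_polynomial:
  assumes "e > 0"
  shows "\<exists>P. dirichlet_polynomial P \<and> (\<forall>s. norm s \<le> S \<longrightarrow> norm (s - P s) < e)"
proof -
  \<comment> \<open>A positive bound lets the asymptotic decision procedure determine the sign of the exponent.\<close>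
  define S' where "S' = max S 1"
  have S': "S' > 0" "S \<le> S'" by (auto simp: S'_def)
  have "(\<lambda>N. exp (3 * ln (real N) * S') / (3 * ln (real N)) * (1/2) ^ (N - 1)) \<longlonglongrightarrow> 0"
    using S' by real_asymp
  then have "eventually (\<lambda>N. exp (3 * ln (real N) * S') / (3 * ln (real N)) * (1/2) ^ (N - 1) < e) sequentially"
    using assms by (rule order_tendstoD)
  then have "eventually (\<lambda>N. 2 \<le> N \<and>
      exp (3 * ln (real N) * S') / (3 * ln (real N)) * (1/2) ^ (N - 1) < e) sequentially"
    by (intro eventually_conj eventually_ge_at_top)
  then obtain N where N: "N \<ge> 2" "exp (3 * ln (real N) * S') / (3 * ln (real N)) * (1/2) ^ (N - 1) < e"
    using eventually_happens'[OF sequentially_bot] by blast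
  define node where "node = (\<lambda>j. complex_of_real (ln (real j)))"
  have inj: "inj_on node {2..N}"
    by (auto simp: inj_on_def node_def)
  have card: "card (node ` {2..N}) = N - 1"
    using card_image[OF inj] by simp
  have "\<exists>c0 c. \<forall>s. norm (s - (c0 + (\<Sum>x\<in>node ` {2..N}. c x * exp (- x * s))))
           \<le> exp (3 * ln (real N) * norm s) / (3 * ln (real N)) * (1/2) ^ card (node ` {2..N})"
    using N by (intro identity_approx_by_exponentials) (auto simp: node_def)
  then obtain c0 c where c: "\<And>s. norm (s - (c0 + (\<Sum>x\<in>node ` {2..N}. c x * exp (- x * s))))
           \<le> exp (3 * ln (real N) * norm s) / (3 * ln (real N)) * (1/2) ^ (N - 1)"
    unfolding card by blast
  define P where "P = (\<lambda>s. c0 + (\<Sum>j = 2..N. c (node j) * (1 / of_nat j powr s)))"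
  have P: "P s = c0 + (\<Sum>x\<in>node ` {2..N}. c x * exp (- x * s))" for s
    unfolding P_def sum.reindex[OF inj] by (simp add: of_nat_powr_conv_exp node_def)
  have "norm (s - P s) < e" if "norm s \<le> S" for s
  proof -
    have "norm (s - P s) \<le> exp (3 * ln (real N) * norm s) / (3 * ln (real N)) * (1/2) ^ (N - 1)"
      unfolding P by (rule c)
    also have "\<dots> \<le> exp (3 * ln (real N) * S') / (3 * ln (real N)) * (1/2) ^ (N - 1)"
      using that S' N by (intro mult_right_mono divide_right_mono) (auto intro!: mult_left_mono)
    finally show ?thesis using N by simp
  qed
  moreover have "dirichlet_polynomial P"
    unfolding P_def
    by (intro dirichlet_polynomial_add dirichlet_polynomial_const dirichlet_polynomial_sum
          dirichlet_polynomial_monomial) auto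
  ultimately show ?thesis by blast
qed

section \<open>Uniform limits of polynomials in a given function\<close>

text \<open>
  For bounded \<open>h\<close>: on \<open>K\<close>, the function \<open>g\<close> lies in the closed unital algebra generated by \<open>h\<close>.
\<close>

definition poly_approx :: "complex set \<Rightarrow> (complex \<Rightarrow> complex) \<Rightarrow> (complex \<Rightarrow> complex) \<Rightarrow> bool"
  where "poly_approx K h g \<longleftrightarrow> (\<forall>e>0. \<exists>p. \<forall>s\<in>K. norm (g s - poly p (h s)) < e)"

text \<open>
  Only \<open>x\<close> is required to lie in the disc: \<open>y\<close> will be an approximation of \<open>x\<close> whose own bound is
  not known beforehand.
\<close>

lemma poly_uniformly_continuous_bounded:
  fixes p :: "complex poly"
  assumes "e > 0"
  shows "\<exists>d>0. \<forall>x y. norm x \<le> C \<longrightarrow> norm (x - y) < d \<longrightarrow> norm (poly p x - poly p y) < e"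
proof -
  have ucont: "uniformly_continuous_on (cball 0 (C + 1)) (poly p)"
    by (intro compact_uniformly_continuous continuous_intros) auto
  obtain d where d: "d > 0" "\<And>x y. x \<in> cball 0 (C + 1) \<Longrightarrow> y \<in> cball 0 (C + 1) \<Longrightarrow>
      dist y x < d \<Longrightarrow> dist (poly p y) (poly p x) < e"
    by (rule uniformly_continuous_onE[OF ucont assms]) blast
  have "norm (poly p x - poly p y) < e" if "norm x \<le> C" "norm (x - y) < min d 1" for x y
  proof -
    have "norm y \<le> norm x + norm (x - y)" 
      using norm_triangle_sub[of y x] by (simp add: norm_minus_commute)
    then have "dist (poly p x) (poly p y) < e"
      using that by (intro d) (auto simp: dist_norm)
    then show ?thesis by (simp add: dist_norm)
  qed
  then show ?thesis using d(1) by (intro exI[of _ "min d 1"]) auto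
qed

lemma poly_approx_poly: "poly_approx K h (\<lambda>s. poly p (h s))"
  unfolding poly_approx_def by (auto intro!: exI[of _ p])

lemma poly_approx_refl: "poly_approx K h h"
  using poly_approx_poly[of K h "[:0, 1:]"] by (simp add: mult.commute)

lemma poly_approx_trans:
  assumes g: "poly_approx K h g" and h: "poly_approx K k h"
    and bdd: "\<exists>C. \<forall>s\<in>K. norm (h s) \<le> C"
  shows "poly_approx K k g"
  unfolding poly_approx_def
proof (intro allI impI)
  fix e :: real assume "e > 0"
  then have e: "e / 2 > 0" by simp
  obtain C where C: "\<And>s. s \<in> K \<Longrightarrow> norm (h s) \<le> C" using bdd by auto
  obtain p where p: "\<And>s. s \<in> K \<Longrightarrow> norm (g s - poly p (h s)) < e / 2"
    using g[unfolded poly_approx_def, rule_format, OF e] by blast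
  obtain d where d: "d > 0" "\<And>x y. norm x \<le> C \<Longrightarrow> norm (x - y) < d \<Longrightarrow> norm (poly p x - poly p y) < e / 2"
    using poly_uniformly_continuous_bounded[OF e, of C p] by blast
  obtain q where q: "\<And>s. s \<in> K \<Longrightarrow> norm (h s - poly q (k s)) < d"
    using h[unfolded poly_approx_def, rule_format, OF d(1)] by blast
  have "norm (g s - poly (pcompose p q) (k s)) < e" if s: "s \<in> K" for s
    using norm_triangle_lt[of "g s - poly p (h s)" "poly p (h s) - poly p (poly q (k s))" e]
      p[OF s] d(2)[OF C[OF s] q[OF s]] by (simp add: poly_pcompose)
  then show "\<exists>p. \<forall>s\<in>K. norm (g s - poly p (k s)) < e" by blast
qed

lemma poly_approx_geometric:
  assumes "\<And>s. s \<in> K \<Longrightarrow> norm (l s) \<le> 1/2"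
  shows "poly_approx K l (\<lambda>s. 1 / (1 - l s))"
  unfolding poly_approx_def
proof (intro allI impI)
  fix e :: real assume "e > 0"
  then obtain n where n: "(1/2::real) ^ n < e / 2"
    using real_arch_pow_inv[of "e / 2" "1 / 2"] by auto
  have "norm (1 / (1 - l s) - poly (\<Sum>i<n. monom 1 i) (l s)) < e" if s: "s \<in> K" for s
  proof -
    have l: "norm (l s) \<le> 1/2" using assms[OF s] .
    then have l1: "l s \<noteq> 1" by auto
    have "norm (1 - l s) \<ge> 1/2"
      using norm_triangle_ineq2[of 1 "l s"] l by simp
    moreover have "1 / (1 - l s) - poly (\<Sum>i<n. monom 1 i) (l s) = l s ^ n / (1 - l s)"
      using l1 by (simp add: poly_sum poly_monom sum_gp_strict field_simps)
    moreover have "norm (l s) ^ n \<le> (1/2) ^ n"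
      using l by (intro power_mono) auto
    ultimately have "norm (1 / (1 - l s) - poly (\<Sum>i<n. monom 1 i) (l s)) \<le> (1/2) ^ n / (1/2)"
      by (simp only: norm_divide norm_power) (intro frac_le, auto)
    then show ?thesis using n by simp
  qed
  then show "\<exists>p. \<forall>s\<in>K. norm (1 / (1 - l s) - poly p (l s)) < e" by blast
qed

text \<open>
  All changes of poles below are Moebius transformations of the value of \<open>h\<close>. Each of them is a
  composition of the map \<open>1 / (1 - x)\<close> with affine maps, hence expands into a geometric series.
\<close>

lemma poly_approx_moebius:
  assumes l: "\<And>s. s \<in> K \<Longrightarrow> norm (\<alpha> + \<beta> * h s) \<le> 1/2"
    and g: "\<And>s. s \<in> K \<Longrightarrow> g s = \<gamma> + \<delta> * (1 / (1 - (\<alpha> + \<beta> * h s)))"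
  shows "poly_approx K h g"
proof -
  let ?l = "\<lambda>s. \<alpha> + \<beta> * h s" and ?m = "\<lambda>s. 1 / (1 - (\<alpha> + \<beta> * h s))"
  have 1: "poly_approx K h ?l"
    using poly_approx_poly[of K h "[:\<alpha>, \<beta>:]"] by (simp add: mult.commute)
  have 2: "poly_approx K ?l ?m"
    using l by (rule poly_approx_geometric)
  have "norm (?m s) \<le> 2" if "s \<in> K" for s
  proof -
    have "norm (1 - ?l s) \<ge> 1/2"
      using norm_triangle_ineq2[of 1 "?l s"] l[OF that] by simp
    then have "1 / norm (1 - ?l s) \<le> 1 / (1/2)" by (intro divide_left_mono) auto
    then show ?thesis by (simp add: norm_divide)
  qed
  then have mb: "\<exists>C. \<forall>s\<in>K. norm (?m s) \<le> C" by blast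
  have 3: "poly_approx K ?m g"
    using poly_approx_poly[of K ?m "[:\<gamma>, \<delta>:]"] g
    by (simp add: poly_approx_def mult.commute)
  have lb: "\<exists>C. \<forall>s\<in>K. norm (?l s) \<le> C" using l by blast
  show ?thesis
    by (rule poly_approx_trans[OF 3 poly_approx_trans[OF 2 1 lb] mb])
qed

section \<open>Moving poles within a component of the complement\<close>

text \<open>
  The function \<open>1 / (s - a)\<close> for a finite point \<open>a\<close>, and \<open>s\<close> for the point at infinity: the principal
  parts at \<open>w\<close> are the polynomials in this function.
\<close>

definition simple_pole_at :: "complex option \<Rightarrow> complex \<Rightarrow> complex"
  where "simple_pole_at = transplant (\<lambda>x. x)"

lemma simple_pole_at_simps:
  "simple_pole_at None s = s" "simple_pole_at (Some a) s = 1 / (s - a)"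
  by (simp_all add: simple_pole_at_def transplant_def)

lemma transplant_conv_simple_pole: "transplant P w s = P (simple_pole_at w s)"
  by (simp add: simple_pole_at_def transplant_def split: option.split)

lemma simple_pole_at_bounded:
  assumes "compact K" "w \<notin> Some ` K"
  shows "\<exists>C. \<forall>s\<in>K. norm (simple_pole_at w s) \<le> C"
proof -
  have "continuous_on K (simple_pole_at w)"
  proof (cases w)
    case None
    then show ?thesis by (simp add: simple_pole_at_simps continuous_on_id cong: continuous_on_cong)
  next
    case (Some a)
    then have "continuous_on K (\<lambda>s. 1 / (s - a))"
      using assms by (intro continuous_intros) auto
    then show ?thesis by (simp add: Some simple_pole_at_simps cong: continuous_on_cong)
  qed
  then have "bounded (simple_pole_at w ` K)"
    using assms(1) by (intro compact_imp_bounded compact_continuous_image)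
  then show ?thesis by (auto simp: bounded_iff)
qed

text \<open>
  With \<open>x = (b - a) / (s - a)\<close> one has \<open>1 / (1 - x) = 1 + (b - a) / (s - b)\<close>.
\<close>

lemma push_finite_pole:
  assumes d: "d > 0" and near: "norm (b - a) \<le> d / 2" and dist: "\<And>s. s \<in> K \<Longrightarrow> d \<le> norm (s - a)"
  shows "poly_approx K (simple_pole_at (Some a)) (simple_pole_at (Some b))"
proof (cases "a = b")
  case True
  then show ?thesis
    by (simp add: poly_approx_refl)
next
  case False
  have far: "s \<noteq> a" "s \<noteq> b" if "s \<in> K" for s
    using dist[OF that] d near by auto
  show ?thesis
  proof (rule poly_approx_moebius)
    fix s assume s: "s \<in> K"
    have "norm (b - a) / norm (s - a) \<le> (d / 2) / d"
      using dist[OF s] d near by (intro frac_le) auto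
    then show "norm (0 + (b - a) * simple_pole_at (Some a) s) \<le> 1/2"
      using d by (simp add: simple_pole_at_simps norm_divide)
    have "1 - (b - a) / (s - a) = (s - b) / (s - a)"
      using far[OF s] by (simp add: divide_simps)
    then show "simple_pole_at (Some b) s
        = - 1 / (b - a) + 1 / (b - a) * (1 / (1 - (0 + (b - a) * simple_pole_at (Some a) s)))"
      using far[OF s] False by (simp add: simple_pole_at_simps divide_simps)
  qed
qed

text \<open>
  With \<open>x = s / b\<close> one has \<open>1 / (1 - x) = - b / (s - b)\<close>.
\<close>

lemma push_pole_from_infinity:
  assumes "S > 0" "\<And>s. s \<in> K \<Longrightarrow> norm s \<le> S" "norm b \<ge> 3 * S"
  shows "poly_approx K (simple_pole_at None) (simple_pole_at (Some b))"
proof (rule poly_approx_moebius)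
  have b: "b \<noteq> 0" using assms by auto
  fix s assume s: "s \<in> K"
  have sb: "s \<noteq> b" using assms(1,3) assms(2)[OF s] by auto
  show "norm (0 + 1 / b * simple_pole_at None s) \<le> 1/2"
    using assms(1,3) assms(2)[OF s] b by (simp add: simple_pole_at_simps norm_divide divide_simps)
  have "1 - s / b = (b - s) / b" using b by (simp add: divide_simps)
  then show "simple_pole_at (Some b) s
      = 0 + (- 1 / b) * (1 / (1 - (0 + 1 / b * simple_pole_at None s)))"
    using b sb by (simp add: simple_pole_at_simps divide_simps)
qed

text \<open>
  The function \<open>x = s / (s - b) = 1 + b / (s - b)\<close> is small for large \<open>b\<close>, and
  \<open>1 / (1 - x) = 1 - s / b\<close>.
\<close>

lemma push_pole_to_infinity:
  assumes "S > 0" "\<And>s. s \<in> K \<Longrightarrow> norm s \<le> S" "norm b \<ge> 3 * S"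
  shows "poly_approx K (simple_pole_at (Some b)) (simple_pole_at None)"
proof (rule poly_approx_moebius)
  have b: "b \<noteq> 0" using assms by auto
  fix s assume s: "s \<in> K"
  have sb: "s \<noteq> b" using assms(1,3) assms(2)[OF s] by auto
  have 1: "1 + b / (s - b) = s / (s - b)" using sb by (simp add: divide_simps)
  have "norm b - norm s \<le> norm (s - b)" 
    using norm_triangle_ineq2[of b s] by (simp add: norm_minus_commute)
  then have "2 * S \<le> norm (s - b)" using assms(3) assms(2)[OF s] by simp
  then have "norm s / norm (s - b) \<le> S / (2 * S)"
    using assms(1) assms(2)[OF s] by (intro frac_le) auto
  then show "norm (1 + b * simple_pole_at (Some b) s) \<le> 1/2"
    using assms(1) 1 by (simp add: simple_pole_at_simps norm_divide)
  have "1 - s / (s - b) = - b / (s - b)" using sb by (simp add: divide_simps)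
  then show "simple_pole_at None s
      = b + (- b) * (1 / (1 - (1 + b * simple_pole_at (Some b) s)))"
    using b sb by (simp add: simple_pole_at_simps)
qed

lemma simple_pole_locally_equivalent:
  assumes K: "compact K" and w: "w \<in> topspace riemann_sphere - Some ` K"
  shows "\<exists>U. openin (subtopology riemann_sphere (topspace riemann_sphere - Some ` K)) U \<and> w \<in> U \<and>
           (\<forall>v\<in>U. poly_approx K (simple_pole_at w) (simple_pole_at v) \<and>
                  poly_approx K (simple_pole_at v) (simple_pole_at w))"
proof (cases w)
  case (Some a)
  then have a: "a \<notin> K" using w by auto
  obtain d where d: "d > 0" "\<And>s. s \<in> K \<Longrightarrow> d \<le> dist a s"
    using separate_point_closed[OF compact_imp_closed[OF K] a] by blast
  \<comment> \<open>The radius \<open>d / 3\<close> serves both directions: \<open>b\<close> keeps the distance \<open>2 * d / 3\<close> from \<open>K\<close>,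
      and \<open>d / 3\<close> is half of that.\<close>
  let ?U = "Some ` ball a (d / 3)"
  have "ball a (d / 3) \<inter> K = {}" using d by force
  then have "?U \<subseteq> topspace riemann_sphere - Some ` K" by auto
  moreover have "openin riemann_sphere ?U" by simp
  ultimately have "openin (subtopology riemann_sphere (topspace riemann_sphere - Some ` K)) ?U"
    by (intro subset_openin_subtopology)
  moreover have "poly_approx K (simple_pole_at (Some a)) (simple_pole_at (Some b)) \<and>
      poly_approx K (simple_pole_at (Some b)) (simple_pole_at (Some a))"
    if b: "b \<in> ball a (d / 3)" for b
  proof
    have ab: "norm (b - a) < d / 3" using b by (simp add: dist_norm norm_minus_commute)
    show "poly_approx K (simple_pole_at (Some a)) (simple_pole_at (Some b))"
    proof (rule push_finite_pole[of d])
      show "d \<le> norm (s - a)" if "s \<in> K" for s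
        using d(2)[OF that] by (simp add: dist_norm norm_minus_commute)
    qed (use d(1) ab in auto)
    show "poly_approx K (simple_pole_at (Some b)) (simple_pole_at (Some a))"
    proof (rule push_finite_pole[of "2 * d / 3"])
      show "norm (a - b) \<le> 2 * d / 3 / 2" using ab by (simp add: norm_minus_commute)
      fix s assume "s \<in> K"
      then have "d \<le> norm (s - a)" using d(2)[of s] by (simp add: dist_norm norm_minus_commute)
      also have "\<dots> \<le> norm (s - b) + norm (b - a)"
        using norm_triangle_ineq[of "s - b" "b - a"] by simp
      finally show "2 * d / 3 \<le> norm (s - b)" using ab by simp
    qed (use d in simp)
  qed
  ultimately show ?thesis
    unfolding Some using d by (intro exI[of _ ?U]) auto
next
  case None
  obtain S where S: "S > 0" "\<And>s. s \<in> K \<Longrightarrow> norm s \<le> S"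
    using compact_imp_bounded[OF K] by (auto simp: bounded_pos)
  let ?U = "insert None (Some ` (topspace euclidean - cball (0 :: complex) (3 * S)))"
  have "s \<in> cball 0 (3 * S)" if "s \<in> K" for s using S that by force
  then have "?U \<subseteq> topspace riemann_sphere - Some ` K" by auto
  moreover have "openin riemann_sphere ?U"
    unfolding openin_Alexandroff_compactification
    by (intro disjI2 exI[of _ "cball (0 :: complex) (3 * S)"]) auto
  ultimately have "openin (subtopology riemann_sphere (topspace riemann_sphere - Some ` K)) ?U"
    by (intro subset_openin_subtopology)
  then show ?thesis
    unfolding None
  proof (intro exI[of _ ?U] conjI ballI)
    fix v assume "v \<in> ?U"
    then consider "v = None" | b where "v = Some b" "3 * S \<le> norm b" by auto
    then show "poly_approx K (simple_pole_at None) (simple_pole_at v)"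
      "poly_approx K (simple_pole_at v) (simple_pole_at None)"
      using push_pole_from_infinity[OF S, where K = K] push_pole_to_infinity[OF S, where K = K]
      by (cases; simp add: poly_approx_refl)+
  qed auto
qed

text \<open>
  The points \<open>u\<close> off \<open>K\<close> to which the pole can be moved from \<open>v\<close> form an open set by the local
  statement in one direction and a closed set by the local statement in the other direction, so
  they include the whole component of \<open>v\<close>.
\<close>

lemma simple_poles_equivalent_on_component:
  assumes K: "compact K"
    and C: "C \<in> connected_components_of
              (subtopology riemann_sphere (topspace riemann_sphere - Some ` K))"
    and v: "v \<in> C" and w: "w \<in> C"
  shows "poly_approx K (simple_pole_at v) (simple_pole_at w)"
proof -
  let ?X = "subtopology riemann_sphere (topspace riemann_sphere - Some ` K)"
  define T where "T = {u \<in> topspace ?X. poly_approx K (simple_pole_at v) (simple_pole_at u)}"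
  have X: "topspace ?X = topspace riemann_sphere - Some ` K" by auto
  have trans: "poly_approx K (simple_pole_at v) (simple_pole_at y)"
    if "poly_approx K (simple_pole_at x) (simple_pole_at y)"
      "poly_approx K (simple_pole_at v) (simple_pole_at x)" "x \<in> topspace ?X" for x y
  proof (rule poly_approx_trans[OF that(1,2)])
    have "x \<notin> Some ` K" using that(3) unfolding X by simp
    then show "\<exists>C. \<forall>s\<in>K. norm (simple_pole_at x s) \<le> C" by (rule simple_pole_at_bounded[OF K])
  qed
  have nbhd: "\<exists>U. openin ?X U \<and> u \<in> U \<and> U \<subseteq> topspace ?X \<and>
      (\<forall>x\<in>U. poly_approx K (simple_pole_at u) (simple_pole_at x) \<and>
             poly_approx K (simple_pole_at x) (simple_pole_at u))" if u: "u \<in> topspace ?X" for u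
  proof -
    obtain U where U: "openin ?X U" "u \<in> U"
      "\<forall>x\<in>U. poly_approx K (simple_pole_at u) (simple_pole_at x) \<and>
             poly_approx K (simple_pole_at x) (simple_pole_at u)"
      using simple_pole_locally_equivalent[OF K u[unfolded X]] by blast
    then show ?thesis using openin_subset[OF U(1)] by blast
  qed
  have "openin ?X T"
  proof (subst openin_subopen, intro ballI)
    fix u assume u: "u \<in> T"
    then have uX: "u \<in> topspace ?X" and vu: "poly_approx K (simple_pole_at v) (simple_pole_at u)"
      by (auto simp only: T_def)
    obtain U where U: "openin ?X U" "u \<in> U" "U \<subseteq> topspace ?X"
      "\<And>x. x \<in> U \<Longrightarrow> poly_approx K (simple_pole_at u) (simple_pole_at x)"
      using nbhd[OF uX] by blast
    have "x \<in> T" if "x \<in> U" for x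
      using trans[OF U(4)[OF that] vu uX] U(3) that by (auto simp only: T_def)
    then show "\<exists>U. openin ?X U \<and> u \<in> U \<and> U \<subseteq> T" using U(1,2) by blast
  qed
  moreover have "openin ?X (topspace ?X - T)"
  proof (subst openin_subopen, intro ballI)
    fix u assume u: "u \<in> topspace ?X - T"
    then have uX: "u \<in> topspace ?X" and vu: "\<not> poly_approx K (simple_pole_at v) (simple_pole_at u)"
      by (auto simp only: T_def)
    obtain U where U: "openin ?X U" "u \<in> U" "U \<subseteq> topspace ?X"
      "\<And>x. x \<in> U \<Longrightarrow> poly_approx K (simple_pole_at x) (simple_pole_at u)"
      using nbhd[OF uX] by blast
    have "x \<notin> T" if "x \<in> U" for x
      using trans[OF U(4)[OF that]] vu by (auto simp only: T_def)
    then show "\<exists>U. openin ?X U \<and> u \<in> U \<and> U \<subseteq> topspace ?X - T" using U(1-3) by blast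
  qed
  then have "closedin ?X T" by (auto simp: closedin_def T_def)
  moreover have "C \<subseteq> topspace ?X"
    using C by (rule connected_components_of_subset)
  moreover have "connectedin ?X C" using C by (rule connectedin_connected_components_of)
  moreover have "v \<in> T"
    using v \<open>C \<subseteq> topspace ?X\<close> by (auto simp: T_def poly_approx_refl)
  ultimately have "C \<subseteq> T"
    using connectedin_clopen_cases[of ?X C T] v by (auto simp: disjnt_iff)
  then show ?thesis using w by (auto simp: T_def)
qed

section \<open>Partial fractions of rational functions\<close>

text \<open>
  The linear span of the principal parts at points off \<open>K\<close>. Functions are compared on \<open>K\<close> only,
  since the algebraic identities between them fail at the poles, where division by zero yields
  meaningless values.
\<close>

inductive partial_fraction_sum :: "complex set \<Rightarrow> (complex \<Rightarrow> complex) \<Rightarrow> bool" for K where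
  principal_part: "w \<notin> Some ` K \<Longrightarrow> (\<And>s. s \<in> K \<Longrightarrow> g s = poly p (simple_pole_at w s)) \<Longrightarrow>
     partial_fraction_sum K g"
| add: "partial_fraction_sum K g \<Longrightarrow> partial_fraction_sum K h \<Longrightarrow>
     (\<And>s. s \<in> K \<Longrightarrow> f s = g s + h s) \<Longrightarrow> partial_fraction_sum K f"

lemma partial_fraction_sum_cmult:
  assumes "partial_fraction_sum K g" "\<And>s. s \<in> K \<Longrightarrow> f s = c * g s"
  shows "partial_fraction_sum K f"
  using assms
proof (induction arbitrary: f)
  case (principal_part w g p)
  then show ?case
    by (intro partial_fraction_sum.principal_part[of w K f "smult c p"]) auto
next
  case (add g h k)
  show ?case
    by (rule partial_fraction_sum.add[of K "\<lambda>s. c * g s" "\<lambda>s. c * h s"])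
       (use add in \<open>auto simp: algebra_simps\<close>)
qed

text \<open>
  A product of simple poles at different points is a linear combination of them,
  \<open>1 / ((s - a) * (s - b)) = (1 / (s - a) - 1 / (s - b)) / (a - b)\<close>, and
  \<open>s / (s - b) = 1 + b / (s - b)\<close>. Each use of one of these identities lowers by one the power that
  is multiplied by \<open>1 / (s - b)\<close>, whence the induction on the polynomial. For \<open>a = b\<close> the power merely
  increases.
\<close>

lemma partial_fraction_sum_divide_linear:
  assumes "partial_fraction_sum K g" and b: "b \<notin> K" and f: "\<And>s. s \<in> K \<Longrightarrow> f s = g s / (s - b)"
  shows "partial_fraction_sum K f"
  using assms(1) f
proof (induction arbitrary: f)
  case (add g h k)
  show ?case
    by (rule partial_fraction_sum.add[of K "\<lambda>s. g s / (s - b)" "\<lambda>s. h s / (s - b)"])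
       (use add in \<open>auto simp: add_divide_distrib\<close>)
next
  case (principal_part w g p f)
  have pole_b: "partial_fraction_sum K (\<lambda>s. c / (s - b))" for c
    by (rule partial_fraction_sum.principal_part[of "Some b" _ _ "[:0, c:]"])
       (use b in \<open>auto simp: simple_pole_at_simps\<close>)
  have "partial_fraction_sum K (\<lambda>s. poly p (simple_pole_at w s) / (s - b))"
  proof (cases "w = Some b")
    case True
    then show ?thesis
      by (intro partial_fraction_sum.principal_part[of w _ _ "pCons 0 p"])
         (use b in \<open>auto simp: simple_pole_at_simps\<close>)
  next
    case w: False
    show ?thesis
    proof (induction p)
      case 0
      show ?case using pole_b[of 0] by simp
    next
      case (pCons c p)
      have "partial_fraction_sum K
          (\<lambda>s. simple_pole_at w s * poly p (simple_pole_at w s) / (s - b))"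
      proof (cases w)
        case None
        have "partial_fraction_sum K (\<lambda>s. poly p (simple_pole_at w s))"
          using principal_part.hyps(1) by (intro partial_fraction_sum.principal_part) auto
        moreover have "partial_fraction_sum K (\<lambda>s. b * (poly p (simple_pole_at w s) / (s - b)))"
          by (rule partial_fraction_sum_cmult[OF pCons.IH, where c = b]) simp
        ultimately show ?thesis
        proof (rule partial_fraction_sum.add)
          fix s assume "s \<in> K"
          then have "s - b \<noteq> 0" using b by auto
          then show "simple_pole_at w s * poly p (simple_pole_at w s) / (s - b)
              = poly p (simple_pole_at w s) + b * (poly p (simple_pole_at w s) / (s - b))"
            by (simp add: None simple_pole_at_simps field_simps)
        qed
      next
        case (Some a)
        then have ab: "a - b \<noteq> 0" using w by auto
        have "partial_fraction_sum K
            (\<lambda>s. poly (smult (1 / (a - b)) (pCons 0 p)) (simple_pole_at w s))"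
          using principal_part.hyps(1) by (rule partial_fraction_sum.principal_part) (rule refl)
        moreover have "partial_fraction_sum K
            (\<lambda>s. (- 1 / (a - b)) * (poly p (simple_pole_at w s) / (s - b)))"
          by (rule partial_fraction_sum_cmult[OF pCons.IH, where c = "- 1 / (a - b)"]) simp
        ultimately show ?thesis
        proof (rule partial_fraction_sum.add)
          fix s assume "s \<in> K"
          then have "s - b \<noteq> 0" "s - a \<noteq> 0"
            using b principal_part.hyps(1) Some by auto
          then have "1 / (s - a) / (s - b) = 1 / (a - b) * (1 / (s - a)) - 1 / (a - b) * (1 / (s - b))"
            using ab by (simp add: divide_simps)
          then have "1 / (s - a) / (s - b) * P
              = 1 / (a - b) * (1 / (s - a)) * P - 1 / (a - b) * (1 / (s - b)) * P" for P
            by (simp only: left_diff_distrib)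
          then show "simple_pole_at w s * poly p (simple_pole_at w s) / (s - b)
              = poly (smult (1 / (a - b)) (pCons 0 p)) (simple_pole_at w s)
                + (- 1 / (a - b)) * (poly p (simple_pole_at w s) / (s - b))"
            by (simp add: Some simple_pole_at_simps)
        qed
      qed
      then show ?case
        by (rule partial_fraction_sum.add[OF pole_b[of c]]) (simp add: add_divide_distrib)
    qed
  qed
  then show ?case
    by (rule partial_fraction_sum_cmult[of _ _ _ 1]) (use principal_part in auto)
qed

text \<open>
  Division by \<open>q\<close> amounts to successive division by its linear factors.
\<close>

lemma partial_fraction_sum_rational:
  fixes p q :: "complex poly"
  assumes "q \<noteq> 0" "\<And>s. s \<in> K \<Longrightarrow> poly q s \<noteq> 0" "\<And>s. s \<in> K \<Longrightarrow> r s = poly p s / poly q s"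
  shows "partial_fraction_sum K r"
  using assms
proof (induction "degree q" arbitrary: q r)
  case 0
  obtain c where q: "q = [:c:]" by (rule degree_eq_zeroE[OF 0(1)[symmetric]])
  show ?case
    by (rule partial_fraction_sum.principal_part[of None K r "smult (1 / c) p"])
       (use 0 in \<open>auto simp: q simple_pole_at_simps\<close>)
next
  case (Suc n)
  then have "\<not> constant (poly q)" by (simp add: constant_degree)
  then obtain b where b: "poly q b = 0" using fundamental_theorem_of_algebra by blast
  then obtain q' where q: "q = [:- b, 1:] * q'" 
    unfolding poly_eq_0_iff_dvd by (elim dvdE)
  have "q' \<noteq> 0" using Suc.prems(1) q by auto
  then have "degree q = Suc (degree q')" unfolding q by (subst degree_mult_eq) auto
  then have deg: "n = degree q'" using Suc.hyps(2) by simp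
  have "partial_fraction_sum K (\<lambda>s. poly p s / poly q' s)"
    by (rule Suc.hyps(1)[OF deg \<open>q' \<noteq> 0\<close>]) (use Suc.prems(2) q in auto)
  moreover have "b \<notin> K" using Suc.prems(2) b by auto
  ultimately show ?case
    by (rule partial_fraction_sum_divide_linear) (use Suc.prems(3) q in \<open>auto simp: field_simps\<close>)
qed

section \<open>Approximation by rational Dirichlet functions\<close>

definition rational_dirichlet_approx ::
    "complex option set \<Rightarrow> complex set \<Rightarrow> (complex \<Rightarrow> complex) \<Rightarrow> bool"
  where "rational_dirichlet_approx Z K f \<longleftrightarrow>
    (\<forall>e>0. \<exists>(N :: nat) z P. (\<forall>j\<in>{1..N}. z j \<in> Z - Some ` K \<and> dirichlet_polynomial (P j)) \<and>
       (\<forall>s\<in>K. norm (f s - (\<Sum>j = 1..N. transplant (P j) (z j) s)) < e))"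

lemma rational_dirichlet_approx_add:
  assumes f: "rational_dirichlet_approx Z K f" and g: "rational_dirichlet_approx Z K g"
    and h: "\<And>s. s \<in> K \<Longrightarrow> h s = f s + g s"
  shows "rational_dirichlet_approx Z K h"
  unfolding rational_dirichlet_approx_def
proof (intro allI impI)
  fix e :: real assume "e > 0"
  then have e: "e / 2 > 0" by simp
  obtain M z P where M: "\<forall>j\<in>{1..M::nat}. z j \<in> Z - Some ` K \<and> dirichlet_polynomial (P j)"
    "\<And>s. s \<in> K \<Longrightarrow> norm (f s - (\<Sum>j = 1..M. transplant (P j) (z j) s)) < e / 2"
    using f[unfolded rational_dirichlet_approx_def, rule_format, OF e] by blast
  obtain N w Q where N: "\<forall>j\<in>{1..N::nat}. w j \<in> Z - Some ` K \<and> dirichlet_polynomial (Q j)"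
    "\<And>s. s \<in> K \<Longrightarrow> norm (g s - (\<Sum>j = 1..N. transplant (Q j) (w j) s)) < e / 2"
    using g[unfolded rational_dirichlet_approx_def, rule_format, OF e] by blast
  define z' where "z' = (\<lambda>j. if j \<le> M then z j else w (j - M))"
  define P' where "P' = (\<lambda>j. if j \<le> M then P j else Q (j - M))"
  have sum: "(\<Sum>j = 1..M + N. transplant (P' j) (z' j) s)
      = (\<Sum>j = 1..M. transplant (P j) (z j) s) + (\<Sum>j = 1..N. transplant (Q j) (w j) s)" for s
  proof -
    have "(\<Sum>j = 1..M + N. transplant (P' j) (z' j) s)
        = (\<Sum>j = 1..M. transplant (P' j) (z' j) s) + (\<Sum>j = M + 1..M + N. transplant (P' j) (z' j) s)"
      by (rule sum.ub_add_nat) simp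
    also have "(\<Sum>j = M + 1..M + N. transplant (P' j) (z' j) s)
        = (\<Sum>j = 1..N. transplant (P' (j + M)) (z' (j + M)) s)"
      using sum.shift_bounds_cl_nat_ivl[of "\<lambda>j. transplant (P' j) (z' j) s" 1 M N]
      by (simp add: add.commute)
    finally show ?thesis by (simp add: P'_def z'_def)
  qed
  have "z' j \<in> Z - Some ` K \<and> dirichlet_polynomial (P' j)" if "j \<in> {1..M + N}" for j
  proof (cases "j \<le> M")
    case True
    then show ?thesis using that M(1) by (simp add: z'_def P'_def)
  next
    case False
    then have "j - M \<in> {1..N}" using that by auto
    then show ?thesis using False N(1) by (simp add: z'_def P'_def)
  qed
  moreover have "norm (h s - (\<Sum>j = 1..M + N. transplant (P' j) (z' j) s)) < e" if s: "s \<in> K" for s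
  proof -
    have "h s - (\<Sum>j = 1..M + N. transplant (P' j) (z' j) s)
        = (f s - (\<Sum>j = 1..M. transplant (P j) (z j) s)) + (g s - (\<Sum>j = 1..N. transplant (Q j) (w j) s))"
      unfolding sum h[OF s] by simp
    moreover have "norm (f s - (\<Sum>j = 1..M. transplant (P j) (z j) s))
        + norm (g s - (\<Sum>j = 1..N. transplant (Q j) (w j) s)) < e"
      using M(2)[OF s] N(2)[OF s] by simp
    ultimately show ?thesis by (simp only: norm_triangle_lt)
  qed
  ultimately show "\<exists>(N :: nat) z P. (\<forall>j\<in>{1..N}. z j \<in> Z - Some ` K \<and> dirichlet_polynomial (P j)) \<and>
       (\<forall>s\<in>K. norm (h s - (\<Sum>j = 1..N. transplant (P j) (z j) s)) < e)"
    by (intro exI[of _ "M + N"] exI[of _ z'] exI[of _ P']) blast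
qed

text \<open>
  A single Dirichlet polynomial suffices here. Move the pole from \<open>w\<close> to a point \<open>z \<in> Z\<close> of the same
  component, which replaces \<open>p\<close> by a polynomial \<open>q\<close> in the simple pole at \<open>z\<close>. The latter function maps
  \<open>K\<close> into a disc, on which a Dirichlet polynomial \<open>P\<close> close to the identity makes \<open>poly q (P s)\<close> close
  to \<open>poly q s\<close>.
\<close>

lemma rational_dirichlet_approx_principal_part:
  assumes K: "compact K"
    and Z: "\<And>C. C \<in> connected_components_of
                 (subtopology riemann_sphere (topspace riemann_sphere - Some ` K))
              \<Longrightarrow> Z \<inter> C \<noteq> {}"
    and w: "w \<notin> Some ` K" and g: "\<And>s. s \<in> K \<Longrightarrow> g s = poly p (simple_pole_at w s)"
  shows "rational_dirichlet_approx Z K g"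
  unfolding rational_dirichlet_approx_def
proof (intro allI impI)
  let ?X = "subtopology riemann_sphere (topspace riemann_sphere - Some ` K)"
  fix e :: real assume "e > 0"
  then have e: "e / 2 > 0" by simp
  have "w \<in> topspace riemann_sphere" by (cases w) auto
  then have "w \<in> topspace ?X" using w by auto
  then obtain C where C: "C \<in> connected_components_of ?X" "w \<in> C"
    using Union_connected_components_of[of ?X] by blast
  obtain z where z: "z \<in> Z" "z \<in> C" using Z[OF C(1)] by blast
  have zK: "z \<in> Z - Some ` K"
    using z connected_components_of_subset[OF C(1)] by auto
  obtain D where D: "\<And>s. s \<in> K \<Longrightarrow> norm (simple_pole_at z s) \<le> D"
    using simple_pole_at_bounded[OF K, of z] zK by auto
  have "poly_approx K (simple_pole_at w) g"
    using poly_approx_poly[of K "simple_pole_at w" p] g by (simp add: poly_approx_def)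
  then have zg: "poly_approx K (simple_pole_at z) g"
    using simple_poles_equivalent_on_component[OF K C(1) z(2) C(2)] simple_pole_at_bounded[OF K w]
    by (rule poly_approx_trans)
  obtain q where q: "\<And>s. s \<in> K \<Longrightarrow> norm (g s - poly q (simple_pole_at z s)) < e / 2"
    using zg[unfolded poly_approx_def, rule_format, OF e] by blast
  obtain d where d: "d > 0" "\<And>x y. norm x \<le> D \<Longrightarrow> norm (x - y) < d \<Longrightarrow> norm (poly q x - poly q y) < e / 2"
    using poly_uniformly_continuous_bounded[OF e, of D q] by blast
  obtain P where P: "dirichlet_polynomial P" "\<And>s. norm s \<le> D \<Longrightarrow> norm (s - P s) < d"
    using identity_approx_by_dirichlet_polynomial[OF d(1), of D] by blast
  define Q where "Q = (\<lambda>s. poly q (P s))"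
  have "norm (g s - transplant Q z s) < e" if s: "s \<in> K" for s
    using norm_triangle_lt[of "g s - poly q (simple_pole_at z s)"
        "poly q (simple_pole_at z s) - transplant Q z s" e]
      q[OF s] d(2)[OF D[OF s] P(2)[OF D[OF s]]]
    by (simp add: transplant_conv_simple_pole Q_def)
  moreover have "dirichlet_polynomial Q"
    unfolding Q_def by (rule dirichlet_polynomial_poly_compose[OF P(1)])
  ultimately show "\<exists>(N :: nat) z P. (\<forall>j\<in>{1..N}. z j \<in> Z - Some ` K \<and> dirichlet_polynomial (P j)) \<and>
       (\<forall>s\<in>K. norm (g s - (\<Sum>j = 1..N. transplant (P j) (z j) s)) < e)"
    using zK by (intro exI[of _ "1::nat"] exI[of _ "\<lambda>_. z"] exI[of _ "\<lambda>_. Q"]) simp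
qed

lemma rational_dirichlet_approx_partial_fraction_sum:
  assumes K: "compact K"
    and Z: "\<And>C. C \<in> connected_components_of
                 (subtopology riemann_sphere (topspace riemann_sphere - Some ` K))
              \<Longrightarrow> Z \<inter> C \<noteq> {}"
    and r: "partial_fraction_sum K r"
  shows "rational_dirichlet_approx Z K r"
  using r
proof induction
  case (principal_part w g p)
  show ?case
    by (rule rational_dirichlet_approx_principal_part[OF K Z principal_part])
next
  case (add g h f)
  from add.IH add.hyps(3) show ?case by (rule rational_dirichlet_approx_add)
qed

theorem theorem4p4:
  fixes K :: "complex set" and Z :: "complex option set"
    and f :: "complex \<Rightarrow> complex" and \<epsilon> :: real
  assumes "vitushkin_compactum K"
    and "\<And>C. C \<in> connected_components_of
                 (subtopology riemann_sphere (topspace riemann_sphere - Some ` K))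
              \<Longrightarrow> Z \<inter> C \<noteq> {}"
    and "f \<in> A_algebra K"
    and "\<epsilon> > 0"
  shows "\<exists>(N :: nat) (z :: nat \<Rightarrow> complex option) (P :: nat \<Rightarrow> complex \<Rightarrow> complex).
           (\<forall>j\<in>{1..N}. z j \<in> Z - Some ` K \<and> dirichlet_polynomial (P j)) \<and>
           sup_norm_on K (\<lambda>s. f s - (\<Sum>j = 1..N. transplant (P j) (z j) s)) < \<epsilon>"
proof -
  have K: "compact K" using assms(1) by (simp add: vitushkin_compactum_def)
  have "f \<in> R_algebra K" using assms(1,3) by (simp add: vitushkin_compactum_def)
  then obtain r where r: "\<And>n. rational_without_poles_on K (r n)" "uniform_limit K r f sequentially"
    unfolding R_algebra_def by blast
  have "\<forall>\<^sub>F n in sequentially. \<forall>s\<in>K. dist (r n s) (f s) < \<epsilon> / 4"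
    using r(2) assms(4) by (intro uniform_limitD) auto
  then obtain n where n: "\<And>s. s \<in> K \<Longrightarrow> dist (r n s) (f s) < \<epsilon> / 4"
    by (auto simp: eventually_sequentially)
  obtain p q :: "complex poly" where "q \<noteq> 0"
    and pq: "\<forall>s\<in>K. poly q s \<noteq> 0 \<and> r n s = poly p s / poly q s"
    using r(1)[of n] unfolding rational_without_poles_on_def by blast
  then have "partial_fraction_sum K (r n)"
    by (intro partial_fraction_sum_rational[where p = p and q = q]) auto
  then have approx: "rational_dirichlet_approx Z K (r n)"
    by (rule rational_dirichlet_approx_partial_fraction_sum[OF K, rotated]) (rule assms(2))
  have e4: "\<epsilon> / 4 > 0" using assms(4) by simp
  obtain N z P where P: "\<forall>j\<in>{1..N::nat}. z j \<in> Z - Some ` K \<and> dirichlet_polynomial (P j)"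
    "\<And>s. s \<in> K \<Longrightarrow> norm (r n s - (\<Sum>j = 1..N. transplant (P j) (z j) s)) < \<epsilon> / 4"
    using approx[unfolded rational_dirichlet_approx_def, rule_format, OF e4] by blast
  let ?g = "\<lambda>s. f s - (\<Sum>j = 1..N. transplant (P j) (z j) s)"
  have "norm (?g s) \<le> \<epsilon> / 2" if s: "s \<in> K" for s
    using norm_triangle_lt[of "f s - r n s" "r n s - (\<Sum>j = 1..N. transplant (P j) (z j) s)" "\<epsilon> / 2"]
      n[OF s] P(2)[OF s] by (simp add: dist_norm norm_minus_commute)
  then have "sup_norm_on K ?g \<le> \<epsilon> / 2"
  proof (cases "K = {}")
    case True
    then show ?thesis using assms(4) by (simp add: sup_norm_on_def)
  next
    case False
    then show ?thesis
      unfolding sup_norm_on_def using \<open>\<And>s. s \<in> K \<Longrightarrow> norm (?g s) \<le> \<epsilon> / 2\<close>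
      by (simp only: if_False) (rule cSUP_least)
  qed
  then have "sup_norm_on K ?g < \<epsilon>" using assms(4) by simp
  with P(1) show ?thesis by (intro exI conjI)
qed

end
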